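(* Let $p$ be a prime, let $q$ be a power of $p$, let $k \in \mathbb{N}$ with $k \mid q-1$, and let $d \in \mathbb{N}$. Then $h_q(kp^d) = 0$. Equivalently, if $U \le \mathbb{F}_q^{kp^d}$ is cyclically covering, then $U = \mathbb{F}_q^{kp^d}$.
   Context: For a prime power $q$ and $n \in \mathbb{N}$, let $\sigma:\mathbb{F}_q^n\to\mathbb{F}_q^n$ be the cyclic shift $\sigma(\sum_{i=1}^n x_i e_i)=\sum_{i=1}^n x_{i-1}e_i$ (indices mod $n$), where $e_1,\dots,e_n$ is the standard basis. A subspace $U\le \mathbb{F}_q^n$ is cyclically covering if $\bigcup_{r=0}^{n-1}\sigma^r(U)=\mathbb{F}_q^n$. $h_q(n)$ denotes the maximum possible codimension of a cyclically covering subspace of $\mathbb{F}_q^n$. *)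

theory Defs
  imports "Jordan_Normal_Form.VS_Connect" "HOL-Computational_Algebra.Primes"
begin

text \<open>
  The space \<open>F_q^n\<close> is \<open>carrier_vec n :: 'a vec set\<close> over a finite field \<open>'a\<close> with \<open>q\<close> elements.
  Coordinates are indexed by \<open>0, ..., n - 1\<close> instead of \<open>1, ..., n\<close>.
\<close>

text \<open>The summand \<open>n - 1\<close> stands for \<open>- 1\<close> modulo \<open>n\<close>, as subtraction on \<open>nat\<close> truncates.\<close>

definition cyclic_shift :: "nat \<Rightarrow> 'a vec \<Rightarrow> 'a vec" where
  "cyclic_shift n x = vec n (\<lambda>i. x $ ((i + (n - 1)) mod n))"

lemma cyclic_shift_unit_vec:
  assumes "i < n"
  shows "cyclic_shift n (unit_vec n i) = unit_vec n (Suc i mod n)"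
proof (rule eq_vecI)
  fix j assume "j < dim_vec (unit_vec n (Suc i mod n))"
  hence j: "j < n" by simp
  have "((j + (n - 1)) mod n = i) = (j = Suc i mod n)"
  proof (cases j)
    case 0
    have "(Suc i mod n = 0) = (Suc i = n)"
      using assms by (cases "Suc i = n") auto
    with 0 j show ?thesis by auto
  next
    case (Suc j')
    have "j + (n - 1) = j' + n" using Suc j by simp
    hence "(j + (n - 1)) mod n = j'" using Suc j by simp
    thus ?thesis using Suc j assms by (cases "Suc i = n") auto
  qed
  thus "cyclic_shift n (unit_vec n i) $ j = unit_vec n (Suc i mod n) $ j"
    using j assms by (auto simp: cyclic_shift_def unit_vec_def)
qed (simp add: cyclic_shift_def)

definition subspace_vec :: "nat \<Rightarrow> 'a::field vec set \<Rightarrow> bool" where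
  "subspace_vec n U \<longleftrightarrow> VectorSpace.subspace class_ring U (module_vec TYPE('a) n)"

definition codim_vec :: "nat \<Rightarrow> 'a::field vec set \<Rightarrow> nat" where
  "codim_vec n U =
     n - vectorspace.dim class_ring ((module_vec TYPE('a) n)\<lparr>carrier := U\<rparr>)"

definition cyclically_covering :: "nat \<Rightarrow> 'a::field vec set \<Rightarrow> bool" where
  "cyclically_covering n U \<longleftrightarrow>
     subspace_vec n U \<and> (\<Union>r\<in>{0..<n}. (cyclic_shift n ^^ r) ` U) = carrier_vec n"

text \<open>
  The field enters through its type, so \<open>h_q(n)\<close> is \<open>max_covering_codim TYPE('a) n\<close> where
  \<open>CARD('a) = q\<close>. The lemmas below show that \<open>codim_vec\<close> does not truncate on subspaces and that
  the maximum is over a finite set, which is nonempty for \<open>n > 0\<close>.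
\<close>

definition max_covering_codim :: "'a::{field,finite} itself \<Rightarrow> nat \<Rightarrow> nat" where
  "max_covering_codim _ n =
     Max {codim_vec n U | U :: 'a vec set. cyclically_covering n U}"

lemma (in vectorspace) subspace_dim_le_dim:
  assumes W: "VectorSpace.subspace K W V" and fin: "fin_dim"
  shows "vectorspace.dim K (vs W) \<le> dim"
proof -
  interpret W: vectorspace K "vs W" by (rule subspace_is_vs[OF W])
  have sub: "submodule K W V" using W by (simp add: VectorSpace.subspace_def)
  have WV: "W \<subseteq> carrier V" using sub by (simp add: submodule_def)
  have bound: "finite S \<and> card S \<le> dim" if S: "S \<subseteq> carrier (vs W) \<and> W.lin_indpt S" for S
  proof -
    have "S \<subseteq> W" using S by simp
    moreover have "lin_indpt S"
      using S span_li_not_depend(2)[OF \<open>S \<subseteq> W\<close> sub] by simp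
    ultimately show ?thesis using li_le_dim[OF fin] WV by blast
  qed
  have "{} \<subseteq> carrier (vs W) \<and> W.lin_indpt {}"
    by (simp add: W.lin_dep_def)
  then obtain A where A: "finite A" "maximal A (\<lambda>S. S \<subseteq> carrier (vs W) \<and> W.lin_indpt S)"
    using maximal_exists[of "\<lambda>S. S \<subseteq> carrier (vs W) \<and> W.lin_indpt S" dim "{}"] bound by blast
  have "W.dim = card A"
    by (rule W.dim_basis[OF A(1) W.max_li_is_basis[OF A(2)]])
  with bound A(2) show ?thesis by (simp add: maximal_def)
qed

lemma codim_vec_add_dim:
  fixes U :: "'a::field vec set"
  assumes "subspace_vec n U"
  shows "codim_vec n U
      + vectorspace.dim class_ring ((module_vec TYPE('a) n)\<lparr>carrier := U\<rparr>) = n"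
proof -
  interpret vec_space "TYPE('a)" n .
  have U: "VectorSpace.subspace class_ring U V"
    using assms by (simp add: subspace_vec_def)
  have "vectorspace.dim class_ring (vs U) \<le> n"
    using subspace_dim_le_dim[OF U fin_dim] dim_is_n by simp
  thus ?thesis by (simp add: codim_vec_def)
qed

lemma finite_covering_codims:
  "finite {codim_vec n U | U :: 'a::field vec set. cyclically_covering n U}"
  by (rule finite_subset[of _ "{..n}"]) (auto simp: codim_vec_def)

lemma cyclically_covering_carrier_vec:
  assumes "n > 0"
  shows "cyclically_covering n (carrier_vec n :: 'a::field vec set)"
proof -
  interpret vec_space "TYPE('a)" n .
  have "(cyclic_shift n ^^ r) x \<in> carrier_vec n"
    if "x \<in> carrier_vec n" for r and x :: "'a vec"
    using that by (induction r) (auto simp: cyclic_shift_def)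
  moreover have "x \<in> (cyclic_shift n ^^ 0) ` carrier_vec n"
    if "x \<in> carrier_vec n" for x :: "'a vec"
    using that by simp
  ultimately have "(\<Union>r\<in>{0..<n}. (cyclic_shift n ^^ r) ` carrier_vec n) = (carrier_vec n :: 'a vec set)"
    using assms by (auto intro!: bexI[of _ 0])
  moreover have "subspace_vec n (carrier_vec n :: 'a vec set)"
    unfolding subspace_vec_def
    by (unfold_locales) (auto simp: module_vec_simps)
  ultimately show ?thesis by (simp add: cyclically_covering_def)
qed

end

theory Submission
  imports Defs
begin

text \<open>
  A proper subspace is contained in a hyperplane, the kernel of a functional \<open>g\<close>. The sequences
  \<open>r \<mapsto> g (\<sigma>\<^sup>r x)\<close> form a nonzero space \<open>W\<close> of \<open>n\<close>-periodic sequences that is invariant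
  under the shift operator \<open>S\<close>. Since \<open>n\<close> divides \<open>(q - 1) p\<^sup>d\<close>, the operator
  \<open>(S\<^sup>q - S) ^ p\<^sup>d\<close> vanishes on \<open>W\<close>; its polynomial is a product of linear factors, so \<open>S\<close> has an
  eigenvector in \<open>W\<close>. By periodicity the eigenvalue is nonzero, so this is a geometric sequence
  without zeros, and a vector \<open>x\<close> that induces it has no cyclic shift in the hyperplane.
\<close>

section \<open>Separating functionals\<close>

lemma subspace_vec_iff:
  fixes U :: "'a::field vec set"
  shows "subspace_vec n U \<longleftrightarrow> U \<subseteq> carrier_vec n \<and> 0\<^sub>v n \<in> U
    \<and> (\<forall>x\<in>U. \<forall>y\<in>U. x + y \<in> U) \<and> (\<forall>c. \<forall>x\<in>U. c \<cdot>\<^sub>v x \<in> U)"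
proof -
  interpret vec_space "TYPE('a)" n .
  show ?thesis
    unfolding subspace_vec_def subspace_def submodule_def
    by (auto simp: module_vec_simps vec_module vec_vs class_ring_simps)
qed

lemma finite_carrier_vec: "finite (carrier_vec n :: 'a::finite vec set)"
proof (rule finite_subset)
  show "(carrier_vec n :: 'a vec set) \<subseteq> vec_of_list ` {xs. set xs \<subseteq> UNIV \<and> length xs = n}"
    by (auto intro!: image_eqI[where x = "list_of_vec x" for x] simp: vec_list)
  show "finite (vec_of_list ` {xs :: 'a list. set xs \<subseteq> UNIV \<and> length xs = n})"
    by (intro finite_imageI finite_lists_length_eq) simp
qed

text \<open>Joining a line to a maximal proper subspace will show that the latter is a
  hyperplane.\<close>

lemma subspace_vec_join_line:
  fixes U :: "'a::field vec set"
  assumes U: "subspace_vec n U" and v: "v \<in> carrier_vec n"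
  shows "subspace_vec n {u + c \<cdot>\<^sub>v v | u c. u \<in> U}"
proof -
  have carr: "u \<in> carrier_vec n" if "u \<in> U" for u
    using that U by (auto simp: subspace_vec_iff)
  have add: "(u + c \<cdot>\<^sub>v v) + (u' + c' \<cdot>\<^sub>v v) = (u + u') + (c + c') \<cdot>\<^sub>v v"
    if "u \<in> U" "u' \<in> U" for u u' c c'
    using carr[OF that(1)] carr[OF that(2)] v by (intro eq_vecI) (auto simp: algebra_simps)
  have smult: "a \<cdot>\<^sub>v (u + c \<cdot>\<^sub>v v) = a \<cdot>\<^sub>v u + (a * c) \<cdot>\<^sub>v v" if "u \<in> U" for a c u
    using carr[OF that] v by (intro eq_vecI) (auto simp: algebra_simps)
  show ?thesis
    unfolding subspace_vec_iff
  proof (intro conjI ballI allI)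
    show "{u + c \<cdot>\<^sub>v v | u c. u \<in> U} \<subseteq> carrier_vec n" using carr v by auto
    have "0\<^sub>v n = 0\<^sub>v n + 0 \<cdot>\<^sub>v v" using v by auto
    thus "0\<^sub>v n \<in> {u + c \<cdot>\<^sub>v v | u c. u \<in> U}" using U by (auto simp only: subspace_vec_iff)
  next
    fix x y assume "x \<in> {u + c \<cdot>\<^sub>v v | u c. u \<in> U}" "y \<in> {u + c \<cdot>\<^sub>v v | u c. u \<in> U}"
    then obtain u c u' c' where "u \<in> U" "x = u + c \<cdot>\<^sub>v v" "u' \<in> U" "y = u' + c' \<cdot>\<^sub>v v"
      by blast
    moreover from this have "u + u' \<in> U" using U by (simp add: subspace_vec_iff)
    ultimately show "x + y \<in> {u + c \<cdot>\<^sub>v v | u c. u \<in> U}" using add by blast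
  next
    fix a x assume "x \<in> {u + c \<cdot>\<^sub>v v | u c. u \<in> U}"
    then obtain u c where "u \<in> U" "x = u + c \<cdot>\<^sub>v v" by blast
    moreover from this have "a \<cdot>\<^sub>v u \<in> U" using U by (simp add: subspace_vec_iff)
    ultimately show "a \<cdot>\<^sub>v x \<in> {u + c \<cdot>\<^sub>v v | u c. u \<in> U}" using smult by blast
  qed
qed

text \<open>By finiteness some proper subspace \<open>H\<close> containing \<open>U\<close> is
  maximal. For any \<open>v\<close> outside \<open>H\<close>, joining the line of \<open>v\<close>
  gives the whole space, so every vector is an element of \<open>H\<close> plus a multiple of
  \<open>v\<close>. The functional reads off the coefficient of \<open>v\<close>.\<close>

lemma exists_separating_functional:
  fixes U :: "'a::{field,finite} vec set"
  assumes U: "subspace_vec n U" and proper: "U \<noteq> carrier_vec n"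
  shows "\<exists>g :: 'a vec \<Rightarrow> 'a. (\<forall>u\<in>U. g u = 0)
    \<and> (\<forall>x\<in>carrier_vec n. \<forall>y\<in>carrier_vec n. g (x + y) = g x + g y)
    \<and> (\<forall>c. \<forall>x\<in>carrier_vec n. g (c \<cdot>\<^sub>v x) = c * g x)
    \<and> (\<exists>v\<in>carrier_vec n. g v = 1)"
proof -
  let ?P = "{H :: 'a vec set. subspace_vec n H \<and> H \<noteq> carrier_vec n}"
  have "finite ?P"
    by (rule finite_subset[of _ "Pow (carrier_vec n)"])
       (auto simp: subspace_vec_iff finite_carrier_vec)
  moreover have "U \<in> ?P" using U proper by simp
  ultimately obtain H where "H \<in> ?P" and UH: "U \<subseteq> H"
    and maxH: "\<forall>H'\<in>?P. H \<subseteq> H' \<longrightarrow> H = H'"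
    by (rule finite_has_maximal2[THEN bexE]) (elim conjE)
  hence H: "subspace_vec n H" "H \<noteq> carrier_vec n" by simp_all
  have Hc: "H \<subseteq> carrier_vec n" and H0: "0\<^sub>v n \<in> H"
    and Hadd: "\<And>x y. x \<in> H \<Longrightarrow> y \<in> H \<Longrightarrow> x + y \<in> H"
    and Hsm: "\<And>c x. x \<in> H \<Longrightarrow> c \<cdot>\<^sub>v x \<in> H"
    using H(1) by (auto simp: subspace_vec_iff)
  obtain v where v: "v \<in> carrier_vec n" "v \<notin> H" using Hc H(2) by auto
  define L where "L = {u + c \<cdot>\<^sub>v v | u c. u \<in> H}"
  have HL: "H \<subseteq> L"
  proof
    fix u assume u: "u \<in> H"
    hence "u = u + 0 \<cdot>\<^sub>v v" using Hc v(1) by (intro eq_vecI) auto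
    thus "u \<in> L" using u unfolding L_def by blast
  qed
  have "v = 0\<^sub>v n + 1 \<cdot>\<^sub>v v" using v(1) by auto
  hence "v \<in> L" using H0 unfolding L_def by blast
  hence "H \<noteq> L" using v(2) by auto
  hence "L \<notin> ?P" using maxH HL by metis
  moreover have "subspace_vec n L"
    unfolding L_def by (rule subspace_vec_join_line[OF H(1) v(1)])
  ultimately have L: "L = carrier_vec n" by simp
  have uniq: "c = c'" if "u \<in> H" "u' \<in> H" "u + c \<cdot>\<^sub>v v = u' + c' \<cdot>\<^sub>v v" for u u' c c'
  proof (rule ccontr)
    assume neq: "c \<noteq> c'"
    have u: "u \<in> carrier_vec n" and u': "u' \<in> carrier_vec n" using that Hc by auto
    \<comment> \<open>For distinct \<open>c\<close> and \<open>c'\<close> the equation can be solved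
      for \<open>v\<close>, which puts \<open>v\<close> into \<open>H\<close>.\<close>
    have "v = (1 / (c - c')) \<cdot>\<^sub>v (u' + (-1) \<cdot>\<^sub>v u)"
    proof (intro eq_vecI)
      fix i assume "i < dim_vec ((1 / (c - c')) \<cdot>\<^sub>v (u' + (-1) \<cdot>\<^sub>v u))"
      hence i: "i < n" using u by auto
      have "(u + c \<cdot>\<^sub>v v) $ i = (u' + c' \<cdot>\<^sub>v v) $ i" using that by simp
      hence "(c - c') * v $ i = u' $ i - u $ i"
        using i u u' v by (simp add: algebra_simps eq_diff_eq)
      hence "v $ i = (u' $ i - u $ i) / (c - c')"
        using neq by (simp add: eq_divide_eq mult.commute)
      thus "v $ i = ((1 / (c - c')) \<cdot>\<^sub>v (u' + (-1) \<cdot>\<^sub>v u)) $ i"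
        using i u u' by simp
    qed (use u u' v in auto)
    moreover have "(1 / (c - c')) \<cdot>\<^sub>v (u' + (-1) \<cdot>\<^sub>v u) \<in> H" using that by (intro Hadd Hsm)
    ultimately have "v \<in> H" by metis
    thus False using v by simp
  qed
  define g where "g x = (THE c. \<exists>u\<in>H. x = u + c \<cdot>\<^sub>v v)" for x
  have g: "g (u + c \<cdot>\<^sub>v v) = c" if "u \<in> H" for u c
    unfolding g_def
  proof (rule the_equality)
    show "\<exists>u'\<in>H. u + c \<cdot>\<^sub>v v = u' + c \<cdot>\<^sub>v v" using that by blast
  next
    fix c' assume "\<exists>u'\<in>H. u + c \<cdot>\<^sub>v v = u' + c' \<cdot>\<^sub>v v"
    then obtain u' where "u' \<in> H" "u + c \<cdot>\<^sub>v v = u' + c' \<cdot>\<^sub>v v" by blast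
    thus "c' = c" using uniq[OF that] by metis
  qed
  show ?thesis
  proof (intro exI[of _ g] conjI ballI allI)
    fix u assume "u \<in> U"
    hence u: "u \<in> H" using UH by auto
    hence "u = u + 0 \<cdot>\<^sub>v v" using Hc v(1) by (intro eq_vecI) auto
    thus "g u = 0" using g[OF u, of 0] by simp
  next
    fix x y :: "'a vec" assume "x \<in> carrier_vec n" "y \<in> carrier_vec n"
    hence "x \<in> L" "y \<in> L" by (simp_all only: L)
    then obtain a b s t where st: "a \<in> H" "x = a + s \<cdot>\<^sub>v v" "b \<in> H" "y = b + t \<cdot>\<^sub>v v"
      unfolding L_def by blast
    have "a \<in> carrier_vec n" "b \<in> carrier_vec n" using st Hc by auto
    hence "x + y = (a + b) + (s + t) \<cdot>\<^sub>v v"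
      using st v by (intro eq_vecI) (auto simp: algebra_simps)
    thus "g (x + y) = g x + g y" using st g Hadd by simp
  next
    fix c and x :: "'a vec" assume "x \<in> carrier_vec n"
    hence "x \<in> L" by (simp only: L)
    then obtain a s where st: "a \<in> H" "x = a + s \<cdot>\<^sub>v v"
      unfolding L_def by blast
    have "a \<in> carrier_vec n" using st Hc by auto
    hence "c \<cdot>\<^sub>v x = c \<cdot>\<^sub>v a + (c * s) \<cdot>\<^sub>v v"
      using st v by (intro eq_vecI) (auto simp: algebra_simps)
    thus "g (c \<cdot>\<^sub>v x) = c * g x" using st g Hsm by simp
  next
    have "g v = 1" using g[OF H0, of 1] v(1) by simp
    thus "\<exists>v\<in>carrier_vec n. g v = 1" using v(1) by blast
  qed
qed

section \<open>The action of polynomials on sequences\<close>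

text \<open>This is the value at \<open>r\<close> of P(S) y, where S is the shift operator on
  sequences: the polynomial ring acts with X as S.\<close>

definition shift_act :: "'a::comm_ring_1 poly \<Rightarrow> (nat \<Rightarrow> 'a) \<Rightarrow> nat \<Rightarrow> 'a" where
  "shift_act P y r = (\<Sum>i\<le>degree P. coeff P i * y (r + i))"

lemma shift_act_0 [simp]: "shift_act 0 y r = 0"
  by (simp add: shift_act_def)

lemma shift_act_pCons [simp]:
  "shift_act (pCons a P) y r = a * y r + shift_act P y (Suc r)"
  \<comment> \<open>The case split is needed because \<open>degree (pCons a P)\<close> is
    \<open>Suc (degree P)\<close> only for nonzero \<open>P\<close>.\<close>
  by (cases "P = 0") (simp_all add: shift_act_def sum.atMost_Suc_shift del: sum.atMost_Suc)

lemma shift_act_add: "shift_act (P + Q) y r = shift_act P y r + shift_act Q y r"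
  by (induction P Q arbitrary: r rule: poly_induct2) (simp_all add: algebra_simps)

lemma shift_act_smult: "shift_act (Polynomial.smult a P) y r = a * shift_act P y r"
  by (induction P arbitrary: r) (simp_all add: algebra_simps)

lemma shift_act_monom: "shift_act (monom a n) y r = a * y (r + n)"
  by (induction n arbitrary: r) (simp_all add: monom_0 monom_Suc)

text \<open>The factor X - a may act first, as S - a, so that linear factors can be peeled off one
  at a time.\<close>

lemma shift_act_linear_factor:
  "shift_act ([:-a, 1:] * P) y r = shift_act P (\<lambda>r. y (Suc r) - a * y r) r"
proof -
  have "shift_act P (\<lambda>r. y (Suc r) - a * y r) r = shift_act P y (Suc r) - a * shift_act P y r"
    by (simp add: shift_act_def sum_distrib_left sum_subtractf algebra_simps)
  moreover have "[:-a, 1:] * P = Polynomial.smult (-a) P + pCons 0 P" by simp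
  ultimately show ?thesis
    by (simp only: shift_act_add shift_act_smult shift_act_pCons) simp
qed

text \<open>The factors S - a are applied to \<open>y\<close> in turn, without leaving
  \<open>W\<close>. As the whole product gives zero, some factor sends a nonzero sequence to zero,
  and that sequence is the eigenvector.\<close>

lemma shift_eigenvector_exists:
  fixes W :: "(nat \<Rightarrow> 'a::comm_ring_1) set"
  assumes closed: "\<And>y a. y \<in> W \<Longrightarrow> (\<lambda>r. y (Suc r) - a * y r) \<in> W"
    and "y \<in> W" and "y \<noteq> (\<lambda>_. 0)"
    and "\<And>r. shift_act (\<Prod>a\<leftarrow>as. [:-a, 1:]) y r = 0"
  shows "\<exists>z\<in>W. z \<noteq> (\<lambda>_. 0) \<and> (\<exists>a. \<forall>r. z (Suc r) = a * z r)"
  using assms(2-)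
proof (induction as arbitrary: y)
  case Nil
  \<comment> \<open>The empty product acts as the identity and cannot annihilate a nonzero
    \<open>y\<close>.\<close>
  thus ?case by (auto simp: one_pCons)
next
  case (Cons a as)
  let ?y = "\<lambda>r. y (Suc r) - a * y r"
  show ?case
  proof (cases "?y = (\<lambda>_. 0)")
    case True
    hence "\<forall>r. y (Suc r) = a * y r" by (simp add: fun_eq_iff)
    thus ?thesis using Cons.prems by blast
  next
    case False
    have "shift_act (\<Prod>a\<leftarrow>as. [:-a, 1:]) ?y r = 0" for r
      using Cons.prems(3)[of r] by (simp only: list.map prod_list.Cons shift_act_linear_factor)
    thus ?thesis using Cons.IH[of ?y] closed[OF Cons.prems(1)] False by blast
  qed
qed

section \<open>The polynomial \<open>X\<^sup>q - X\<close>\<close>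

text \<open>The library has this only for the class \<open>finite_field\<close>, to which the sort
  \<open>{field, finite}\<close> is not subordinate.\<close>

lemma power_card_UNIV_eq:
  fixes x :: "'a::{field,finite}"
  shows "x ^ card (UNIV :: 'a set) = x"
proof (cases "x = 0")
  case False
  let ?A = "UNIV - {0 :: 'a}"
  \<comment> \<open>Multiplication by \<open>x\<close> permutes the nonzero elements, so their
    product is unchanged by the factor \<open>x ^ card ?A\<close> and can be cancelled.\<close>
  have "bij_betw ((*) x) ?A ?A"
    by (rule bij_betw_byWitness[where f' = "\<lambda>y. y / x"]) (use False in auto)
  from prod.reindex_bij_betw[OF this, of id] have "x ^ card ?A * \<Prod>?A = 1 * \<Prod>?A"
    by (simp add: prod.distrib)
  hence "x ^ card ?A = 1" by (subst (asm) mult_right_cancel) auto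
  moreover have "card (UNIV :: 'a set) = Suc (card ?A)"
    by (rule card.remove) auto
  ultimately show ?thesis by (metis power_Suc mult.right_neutral)
qed (simp add: card_gt_0_iff)

text \<open>Both sides are monic of degree q and vanish at all q elements of the field, so their
  difference has more roots than its degree allows unless it is zero.\<close>

lemma monom_card_diff_eq_prod:
  "monom 1 (card (UNIV :: 'a set)) - monom 1 1 = (\<Prod>a\<in>(UNIV :: 'a::{field,finite} set). [:-a, 1:])"
proof -
  let ?q = "card (UNIV :: 'a set)"
  let ?L = "monom 1 ?q - monom 1 1 :: 'a poly" and ?R = "\<Prod>a\<in>(UNIV :: 'a set). [:-a, 1:]"
  have q: "?q > 1"
    using card_mono[of "UNIV :: 'a set" "{0, 1}"] by simp
  have degR: "degree ?R = ?q"
    by (subst degree_prod_eq_sum_degree) auto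
  have degL: "degree ?L = ?q"
    using q by (subst diff_conv_add_uminus, subst degree_add_eq_left) (auto simp: degree_monom_eq)
  show ?thesis
  proof (rule poly_eqI_degree_lead_coeff[where A = UNIV and n = ?q])
    show "coeff ?L ?q = coeff ?R ?q"
      using q lead_coeff_prod[of "\<lambda>a::'a. [:-a, 1:]" UNIV] by (simp add: degR)
    show "poly ?L a = poly ?R a" for a
      by (simp add: poly_monom poly_prod power_card_UNIV_eq)
  qed (use degL degR in auto)
qed

lemma prod_list_power_eq: "prod_list xs ^ k = prod_list (concat (replicate k xs))"
  for xs :: "'a::monoid_mult list"
  by (induction k) simp_all

text \<open>The roots are listed with multiplicity by repeating an enumeration of the field
  \<open>N\<close> times; a list suits the induction over linear factors.\<close>

lemma monom_card_diff_power_splits: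
  "\<exists>as. (monom 1 (card (UNIV :: 'a set)) - monom 1 1) ^ N
    = (\<Prod>a\<leftarrow>as. [:-a, 1 :: 'a::{field,finite}:])"
proof -
  obtain as :: "'a list" where as: "set as = UNIV" "distinct as"
    using finite_distinct_list[of "UNIV :: 'a set"] by auto
  have "(monom 1 (card (UNIV :: 'a set)) - monom 1 1) ^ N = (\<Prod>a\<leftarrow>as. [:-a, 1:]) ^ N"
    unfolding monom_card_diff_eq_prod
    using prod.distinct_set_conv_list[OF as(2), of "\<lambda>a. [:-a, 1:]"] as(1) by simp
  also have "\<dots> = (\<Prod>a\<leftarrow>concat (replicate N as). [:-a, 1:])"
    by (simp add: prod_list_power_eq map_concat)
  finally show ?thesis by blast
qed

text \<open>Translation by 1 permutes the field, so summing \<open>x + 1\<close> over all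
  \<open>x\<close> shows that \<open>p ^ m\<close> is zero in the field. The characteristic is
  therefore a prime dividing \<open>p ^ m\<close>.\<close>

lemma CHAR_eq_prime:
  assumes "prime p" and "card (UNIV :: 'a::{field,finite} set) = p ^ m"
  shows "CHAR('a) = p"
proof -
  have "CHAR('a) > 0" by (rule finite_imp_CHAR_pos) simp
  hence pr: "prime CHAR('a)" by (rule prime_CHAR_semidom)
  have "(\<Sum>x\<in>(UNIV :: 'a set). x + 1) = (\<Sum>x\<in>UNIV. x)"
    by (rule sum.reindex_bij_witness[of _ "\<lambda>x. x - 1" "\<lambda>x. x + 1"]) auto
  hence "of_nat (p ^ m) = (0 :: 'a)"
    using assms(2) by (simp add: sum.distrib)
  hence "CHAR('a) dvd p ^ m" by (simp only: of_nat_eq_0_iff_char_dvd)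
  thus ?thesis using pr assms(1) prime_dvd_power primes_dvd_imp_eq by blast
qed

lemma monom_card_diff_power:
  assumes "prime p" and "card (UNIV :: 'a::{field,finite} set) = p ^ m"
  shows "(monom 1 N - monom 1 1 :: 'a poly) ^ (p ^ d) = monom 1 (N * p ^ d) - monom 1 (p ^ d)"
proof -
  have ch: "CHAR('a poly) = p" using CHAR_eq_prime[OF assms] by simp
  \<comment> \<open>The Frobenius identity is applied to the sum (X^N - X) + X and then rearranged,
    which avoids a sign (-1)^(p^d).\<close>
  have "(monom 1 N - monom 1 1 + monom 1 1 :: 'a poly) ^ (p ^ d)
      = (monom 1 N - monom 1 1) ^ (p ^ d) + monom 1 1 ^ (p ^ d)"
    by (rule freshmans_dream') (use ch assms in auto)
  thus ?thesis by (simp add: monom_power algebra_simps)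
qed

section \<open>Cyclic shifts\<close>

lemma cyclic_shift_carrier [simp]: "cyclic_shift n x \<in> carrier_vec n"
  by (simp add: cyclic_shift_def)

lemma cyclic_shift_funpow_carrier:
  "x \<in> carrier_vec n \<Longrightarrow> (cyclic_shift n ^^ r) x \<in> carrier_vec n"
  by (cases r) simp_all

text \<open>The summand \<open>r * (n - 1)\<close> stands for -r modulo \<open>n\<close>, since each
  shift moves the index back by one.\<close>

lemma cyclic_shift_funpow_index:
  assumes "x \<in> carrier_vec n" and "i < n"
  shows "(cyclic_shift n ^^ r) x $ i = x $ ((i + r * (n - 1)) mod n)"
  using assms(2)
proof (induction r arbitrary: i)
  case (Suc r)
  have "(cyclic_shift n ^^ Suc r) x $ i = (cyclic_shift n ^^ r) x $ ((i + (n - 1)) mod n)"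
    using Suc.prems by (simp add: cyclic_shift_def)
  also have "\<dots> = x $ ((i + (n - 1) + r * (n - 1)) mod n)"
    using Suc.prems by (simp add: Suc.IH mod_add_left_eq)
  finally show ?case by (simp only: mult_Suc add.assoc)
qed (use assms in simp)

lemma cyclic_shift_funpow_self:
  assumes "x \<in> carrier_vec n"
  shows "(cyclic_shift n ^^ n) x = x"
  using assms cyclic_shift_funpow_carrier[OF assms, of n]
  by (intro eq_vecI) (auto simp: cyclic_shift_funpow_index)

lemma cyclic_shift_funpow_combination:
  assumes "x \<in> carrier_vec n" "y \<in> carrier_vec n"
  shows "(cyclic_shift n ^^ r) (x + c \<cdot>\<^sub>v y)
    = (cyclic_shift n ^^ r) x + c \<cdot>\<^sub>v (cyclic_shift n ^^ r) y"
proof -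
  have "x + c \<cdot>\<^sub>v y \<in> carrier_vec n" using assms by simp
  from cyclic_shift_funpow_carrier[OF this, of r] cyclic_shift_funpow_carrier[OF assms(1), of r]
    cyclic_shift_funpow_carrier[OF assms(2), of r]
  show ?thesis
    using assms by (intro eq_vecI) (auto simp: cyclic_shift_funpow_index)
qed

section \<open>Covering subspaces and their codimension\<close>

lemma covering_imp_carrier:
  fixes U :: "'a::{field,finite} vec set"
  assumes p: "prime p" and card: "card (UNIV :: 'a set) = p ^ m"
    and k: "k dvd p ^ m - 1" and n: "n = k * p ^ d" "n > 0"
    and cov: "cyclically_covering n U"
  shows "U = carrier_vec n"
proof (rule ccontr)
  assume proper: "U \<noteq> carrier_vec n"
  let ?\<sigma> = "cyclic_shift n :: 'a vec \<Rightarrow> 'a vec"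
  from cov have U: "subspace_vec n U" by (simp add: cyclically_covering_def)
  obtain g v where gU: "\<And>u. u \<in> U \<Longrightarrow> g u = (0::'a)"
    and gadd: "\<And>x y. x \<in> carrier_vec n \<Longrightarrow> y \<in> carrier_vec n \<Longrightarrow> g (x + y) = g x + g y"
    and gsm: "\<And>c x. x \<in> carrier_vec n \<Longrightarrow> g (c \<cdot>\<^sub>v x) = c * g x"
    and v: "v \<in> carrier_vec n" "g v = 1"
    using exists_separating_functional[OF U proper] by blast
  define Y where "Y x = (\<lambda>r. g ((?\<sigma> ^^ r) x))" for x
  define W where "W = Y ` carrier_vec n"
  have closed: "(\<lambda>r. y (Suc r) - a * y r) \<in> W" if "y \<in> W" for y a
  proof -
    from that obtain x where x: "x \<in> carrier_vec n" "y = Y x" by (auto simp: W_def)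
    \<comment> \<open>If \<open>x\<close> induces \<open>y\<close>, then \<sigma> x - a x induces (S
      - a) y, by linearity of \<open>g\<close> and of the shifts.\<close>
    have "Y (?\<sigma> x + (-a) \<cdot>\<^sub>v x) = (\<lambda>r. y (Suc r) - a * y r)"
    proof
      fix r
      have "(?\<sigma> ^^ r) (?\<sigma> x + (-a) \<cdot>\<^sub>v x) = (?\<sigma> ^^ r) (?\<sigma> x) + (-a) \<cdot>\<^sub>v (?\<sigma> ^^ r) x"
        by (rule cyclic_shift_funpow_combination) (use x in auto)
      thus "Y (?\<sigma> x + (-a) \<cdot>\<^sub>v x) r = y (Suc r) - a * y r"
        using x by (simp add: Y_def gadd gsm cyclic_shift_funpow_carrier funpow_swap1)
    qed
    moreover have "?\<sigma> x + (-a) \<cdot>\<^sub>v x \<in> carrier_vec n" using x by simp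
    ultimately show ?thesis unfolding W_def by (intro image_eqI[OF sym])
  qed
  have period: "y (r + n) = y r" if "y \<in> W" for y r
    using that by (auto simp: W_def Y_def funpow_add cyclic_shift_funpow_self)
  have period_mult: "y (r + n * j) = y r" if "y \<in> W" for y r j
  proof (induction j)
    case (Suc j)
    have "y (r + n * Suc j) = y (r + n * j + n)" by (simp add: algebra_simps)
    thus ?case using period[OF that] Suc by simp
  qed simp
  have vW: "Y v \<in> W" using v by (simp add: W_def)
  have "Y v 0 \<noteq> 0" using v by (simp add: Y_def)
  hence v0: "Y v \<noteq> (\<lambda>_. 0)" by (auto simp: fun_eq_iff)
  obtain j where j: "p ^ m - 1 = k * j" using k by (elim dvdE)
  have "p ^ m > 0" using p by (simp add: prime_gt_0_nat)
  hence "p ^ m = Suc (k * j)" using j by linarith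
  \<comment> \<open>The two exponents of (X^q - X)^(p^d) = X^(q p^d) - X^(p^d) differ by a multiple
    of the period \<open>n\<close>, so this polynomial annihilates \<open>W\<close>.\<close>
  hence ann: "p ^ m * p ^ d = p ^ d + n * j"
    using n by (simp add: algebra_simps)
  obtain as where as: "(monom 1 (p ^ m) - monom 1 1 :: 'a poly) ^ (p ^ d)
      = (\<Prod>a\<leftarrow>as. [:-a, 1:])"
    using monom_card_diff_power_splits[where 'a = 'a and N = "p ^ d"] unfolding card by blast
  have "shift_act (\<Prod>a\<leftarrow>as. [:-a, 1:]) (Y v) r = 0" for r
  proof -
    have "(\<Prod>a\<leftarrow>as. [:-a, 1:]) = monom 1 (p ^ m * p ^ d) + Polynomial.smult (-1) (monom 1 (p ^ d))"
      using monom_card_diff_power[OF p card] as by simp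
    thus ?thesis
      using period_mult[OF vW, of "r + p ^ d" j]
      by (simp only: shift_act_add shift_act_smult shift_act_monom ann)
         (simp add: add.assoc)
  qed
  from shift_eigenvector_exists[OF closed vW v0 this]
  obtain z a where z: "z \<in> W" "z \<noteq> (\<lambda>_. 0)" "\<And>r. z (Suc r) = a * z r" by blast
  have geom: "z r = a ^ r * z 0" for r
    by (induction r) (simp_all add: z(3))
  have z0: "z 0 \<noteq> 0"
  proof
    assume "z 0 = 0"
    hence "z r = 0" for r using geom[of r] by simp
    thus False using z(2) by blast
  qed
  \<comment> \<open>As \<open>n > 0\<close>, the eigenvalue \<open>a = 0\<close> would force
    \<open>z 0 = 0\<close>.\<close>
  have "z 0 = a ^ n * z 0" using period[OF z(1), of 0] geom[of n] by simp
  hence "a \<noteq> 0" using z0 n(2) by (auto simp: power_0_left)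
  hence nz: "z r \<noteq> 0" for r using geom[of r] z0 by simp
  from z(1) obtain x where x: "x \<in> carrier_vec n" "z = Y x" by (auto simp: W_def)
  from cov x(1) have "x \<in> (\<Union>r\<in>{0..<n}. (?\<sigma> ^^ r) ` U)"
    by (simp only: cyclically_covering_def)
  then obtain r u where r: "r < n" "u \<in> U" "x = (?\<sigma> ^^ r) u" by auto
  \<comment> \<open>Shifting \<open>x\<close> by the remaining \<open>n - r\<close> steps completes
    the cycle and returns to \<open>u\<close>, where \<open>g\<close> vanishes; this contradicts
    \<open>nz\<close>.\<close>
  have "u \<in> carrier_vec n" using r U by (auto simp: subspace_vec_iff)
  hence "(?\<sigma> ^^ (n - r + r)) u = u" using r by (simp add: cyclic_shift_funpow_self)
  hence "(?\<sigma> ^^ (n - r)) x = u" using r by (simp only: funpow_add o_apply)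
  hence "z (n - r) = 0" using gU r x by (simp add: Y_def)
  with nz show False by blast
qed

lemma codim_vec_carrier: "codim_vec n (carrier_vec n :: 'a::field vec set) = 0"
proof -
  interpret vec_space "TYPE('a)" n .
  have "(module_vec TYPE('a) n)\<lparr>carrier := carrier_vec n\<rparr> = module_vec TYPE('a) n"
    by (simp add: module_vec_def)
  thus ?thesis unfolding codim_vec_def by (simp only: dim_is_n diff_self_eq_0)
qed

theorem theorem5p1:
  fixes p q m k d :: nat
  assumes "prime p"
    and "m > 0" and "q = p ^ m"
    and "card (UNIV :: 'a::{field,finite} set) = q"
    and "k dvd q - 1"
  shows "max_covering_codim TYPE('a) (k * p ^ d) = 0
    \<and> (\<forall>U :: 'a vec set. cyclically_covering (k * p ^ d) U \<longrightarrow> U = carrier_vec (k * p ^ d))"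
proof -
  let ?n = "k * p ^ d"
  \<comment> \<open>A field has at least two elements, so \<open>q - 1\<close> is nonzero and cannot
    have the divisor 0; this makes \<open>k\<close> positive.\<close>
  have "card {0, 1 :: 'a} \<le> q" using assms(4) card_mono[of "UNIV :: 'a set" "{0, 1}"] by simp
  hence "q - 1 > 0" by simp
  hence "k > 0" using assms(5) by (auto intro: Nat.gr0I)
  hence n: "?n > 0" using assms(1) by (simp add: prime_gt_0_nat)
  have all: "U = carrier_vec ?n" if "cyclically_covering ?n U" for U :: "'a vec set"
    by (rule covering_imp_carrier[OF assms(1) _ _ refl n that]) (use assms in auto)
  \<comment> \<open>The whole space is the only covering subspace, so the maximum is taken over a
    single codimension.\<close>
  have "Collect (cyclically_covering ?n) = {carrier_vec ?n :: 'a vec set}"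
    using all cyclically_covering_carrier_vec[OF n, where 'a = 'a] by blast
  hence "{codim_vec ?n U | U :: 'a vec set. cyclically_covering ?n U} = {0}"
    by (simp add: setcompr_eq_image codim_vec_carrier)
  thus ?thesis using all by (simp add: max_covering_codim_def)
qed

end
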